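(* For every positive integer $n$, $$\overline{\mathrm{spt}}(7n)\equiv \overline{\mathrm{spt}}(n/7)\pmod 4\quad\text{and}\quad \overline{\mathrm{spt}}_{\omega}(7n)\equiv \overline{\mathrm{spt}}_{\omega}(n/7)\pmod 4,$$ with the convention that $\overline{\mathrm{spt}}(x)=\overline{\mathrm{spt}}_{\omega}(x)=0$ if $x$ is not a positive integer.
   Context: $(a;q)_n=\prod_{j=0}^{n-1}(1-aq^j)$, $(a;q)_\infty=\prod_{j\ge0}(1-aq^j)$. $\overline{\mathrm{spt}}(n)$ is defined by $\sum_{n\ge1}\overline{\mathrm{spt}}(n)q^n=\sum_{n\ge1}\frac{q^n(-q^{n+1};q)_\infty}{(1-q^n)^2(q^{n+1};q)_\infty}$. $\overline{\mathrm{spt}}_{\omega}(n)$ is defined by $\sum_{n\ge1}\overline{\mathrm{spt}}_{\omega}(n)q^n=\sum_{n\ge1}\frac{q^{n}(-q^{n+1};q)_{n}(-q^{2n+2};q^2)_{\infty}}{(1-q^n)^2(q^{n+1};q)_n(q^{2n+2};q^2)_{\infty}}$. *)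

theory Defs
  imports "HOL-Computational_Algebra.Formal_Power_Series"
begin

text \<open>q-Pochhammer symbols as formal power series (in the variable q = fps_X),
  over the rationals so that reciprocals of series with constant term 1 exist.
  Infinite products and sums are limits in the standard (X-adic) metric on fps.\<close>

definition qpoch :: "rat fps \<Rightarrow> rat fps \<Rightarrow> nat \<Rightarrow> rat fps" where
  "qpoch a q n = (\<Prod>j<n. 1 - a * q ^ j)"

definition qpoch_inf :: "rat fps \<Rightarrow> rat fps \<Rightarrow> rat fps" where
  "qpoch_inf a q = lim (\<lambda>N. qpoch a q N)"

definition sptbar_gf :: "rat fps" where
  "sptbar_gf = lim (\<lambda>N. \<Sum>n\<in>{1..N}.
      fps_X ^ n * qpoch_inf (- (fps_X ^ (n+1))) fps_X
      * inverse ((1 - fps_X ^ n)\<^sup>2 * qpoch_inf (fps_X ^ (n+1)) fps_X))"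

definition sptbar_omega_gf :: "rat fps" where
  "sptbar_omega_gf = lim (\<lambda>N. \<Sum>n\<in>{1..N}.
      fps_X ^ n * qpoch (- (fps_X ^ (n+1))) fps_X n
        * qpoch_inf (- (fps_X ^ (2*n+2))) (fps_X ^ 2)
      * inverse ((1 - fps_X ^ n)\<^sup>2 * qpoch (fps_X ^ (n+1)) fps_X n
        * qpoch_inf (fps_X ^ (2*n+2)) (fps_X ^ 2)))"

definition sptbar :: "nat \<Rightarrow> rat" where
  "sptbar m = fps_nth sptbar_gf m"

definition sptbar_omega :: "nat \<Rightarrow> rat" where
  "sptbar_omega m = fps_nth sptbar_omega_gf m"

definition at_div7 :: "(nat \<Rightarrow> rat) \<Rightarrow> nat \<Rightarrow> rat" where
  "at_div7 f n = (if 7 dvd n \<and> n > 0 then f (n div 7) else 0)"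

end

(* Write y_k = q^k/(1-q^k). Since (1+q^k)/(1-q^k) = 1 + 2 y_k, modulo 4 the generating functions
   are sum_n q^n/(1-q^n)^2 (1 + 2 sum_{k in K_n} y_k), so that the coefficient at m is
   sigma(m) + 2 c(m), where c(m) counts the solutions of n a + k j = m with a odd and k in K_n.
   As sigma(7n) + 7 sigma(n/7) = 8 sigma(n), sigma satisfies the congruence, and only the parity of
   c remains. For K_n = {k > n}, a bijection and involutions reduce it to the numbers of positive
   solutions of x^2 + 2y^2 = m and 2x^2 + 2y^2 = m. For sptbar_omega the complementary k (odd, k > 2n)
   contribute, by the involution (n,a,k,j) -> (j,k-2n,a+2j,n), the numbers of positive solutions of
   4z^2 = m and 8z^2 = m. None of these forms represents a multiple of 7 except with all
   variables divisible by 7: -1 and -2 are non-residues modulo 7, and 7 divides neither 4 nor 8. *)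
theory Submission
  imports Defs "HOL-Computational_Algebra.Primes"
begin

section \<open>Parity of numbers of solutions\<close>

text \<open>Points that are not fixed fall into pairs \<open>{x, f x}\<close>; the induction removes
  one such pair at a time until only fixed points are left.\<close>

lemma even_card_involution_iff:
  assumes "finite S" and "\<And>x. x \<in> S \<Longrightarrow> f x \<in> S \<and> f (f x) = x"
  shows "even (card S) \<longleftrightarrow> even (card {x \<in> S. f x = x})"
  using assms
proof (induction "card S" arbitrary: S rule: less_induct)
  case less
  show ?case
  proof (cases "\<exists>x\<in>S. f x \<noteq> x")
    case True
    then obtain x where x: "x \<in> S" "f x \<noteq> x" by blast
    define T where "T = S - {x, f x}"
    have fx: "f x \<in> S" "f (f x) = x" using less.prems x by auto
    have "card {x, f x} = 2" using x by auto
    then have card_S: "card S = card T + 2"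
      unfolding T_def using x fx less.prems(1)
      by (metis card_Diff_subset card_mono empty_subsetI finite.emptyI finite.insertI insert_subset
          le_add_diff_inverse2)
    have "f y \<in> T \<and> f (f y) = y" if "y \<in> T" for y
      using less.prems(2)[of y] that fx unfolding T_def by auto
    then have "even (card T) \<longleftrightarrow> even (card {x \<in> T. f x = x})"
      using less.hyps[of T] card_S less.prems(1) unfolding T_def by auto
    moreover have "{x \<in> T. f x = x} = {x \<in> S. f x = x}"
      unfolding T_def using x fx by auto
    ultimately show ?thesis using card_S by simp
  next
    case False
    then have "{x \<in> S. f x = x} = S" by auto
    then show ?thesis by simp
  qed
qed

lemma card_eq_if_inverse:
  assumes "\<And>x. x \<in> S \<Longrightarrow> f x \<in> T \<and> g (f x) = x" and "\<And>y. y \<in> T \<Longrightarrow> g y \<in> S \<and> f (g y) = y"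
  shows "card S = card T"
proof (rule bij_betw_same_card)
  show "bij_betw f S T"
    by (rule bij_betw_byWitness[where f' = g]) (use assms in auto)
qed

section \<open>Sums of two products and their diagonal solutions\<close>

definition products_sum :: "nat \<Rightarrow> nat \<Rightarrow> nat \<Rightarrow> (nat \<times> nat \<times> nat \<times> nat) set" where
  "products_sum c d N =
    {(n, M, r, s). 0 < n \<and> 0 < M \<and> 0 < r \<and> 0 < s \<and> c * n * M + d * r * s = N}"

definition squares_sum :: "nat \<Rightarrow> nat \<Rightarrow> nat \<Rightarrow> (nat \<times> nat) set" where
  "squares_sum c d N = {(x, y). 0 < x \<and> 0 < y \<and> c * x\<^sup>2 + d * y\<^sup>2 = N}"

lemma le_if_mult_eq:
  fixes c u v N :: nat
  assumes "0 < c" "0 < u" "0 < v" "c * u * v \<le> N"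
  shows "u \<le> N" "v \<le> N"
proof -
  have "u \<le> c * u * v" "v \<le> c * u * v" using assms by auto
  then show "u \<le> N" "v \<le> N" using assms by linarith+
qed

lemma finite_products_sum:
  assumes "0 < c" "0 < d"
  shows "finite (products_sum c d N)"
proof (rule finite_subset)
  show "products_sum c d N \<subseteq> {..N} \<times> {..N} \<times> {..N} \<times> {..N}"
  proof (clarsimp simp: products_sum_def, intro conjI)
    fix n M r s :: nat
    assume *: "0 < n" "0 < M" "0 < r" "0 < s"
    show "n \<le> c * n * M + d * r * s" "M \<le> c * n * M + d * r * s"
      using le_if_mult_eq[OF assms(1) *(1,2)] by auto
    show "r \<le> c * n * M + d * r * s" "s \<le> c * n * M + d * r * s"
      using le_if_mult_eq[OF assms(2) *(3,4)] by auto
  qed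
qed auto

text \<open>Swapping \<open>n\<close> with \<open>M\<close> leaves the solutions with
  \<open>n = M\<close>; on these, swapping \<open>r\<close> with \<open>s\<close> leaves those with
  \<open>r = s\<close> as well, which are the representations by squares.\<close>

lemma even_card_products_sum_iff:
  assumes "0 < c" "0 < d"
  shows "even (card (products_sum c d N)) \<longleftrightarrow> even (card (squares_sum c d N))"
proof -
  let ?S = "products_sum c d N" and ?T = "{p \<in> products_sum c d N. fst p = fst (snd p)}"
  have fin: "finite ?S" by (rule finite_products_sum[OF assms])
  have "even (card ?S) \<longleftrightarrow> even (card {p \<in> ?S. (\<lambda>(n, M, r, s). (M, n, r, s)) p = p})"
    by (rule even_card_involution_iff[OF fin]) (auto simp: products_sum_def mult_ac)
  also have "{p \<in> ?S. (\<lambda>(n, M, r, s). (M, n, r, s)) p = p} = ?T" by auto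
  also have "even (card ?T) \<longleftrightarrow> even (card {p \<in> ?T. (\<lambda>(n, M, r, s). (n, M, s, r)) p = p})"
    by (rule even_card_involution_iff) (use fin in \<open>auto simp: products_sum_def mult_ac\<close>)
  also have "{p \<in> ?T. (\<lambda>(n, M, r, s). (n, M, s, r)) p = p} = (\<lambda>(x, y). (x, x, y, y)) ` squares_sum c d N"
    by (auto simp: products_sum_def squares_sum_def power2_eq_square mult_ac image_iff)
  also have "card \<dots> = card (squares_sum c d N)"
    by (rule card_image) (auto simp: inj_on_def)
  finally show ?thesis .
qed

section \<open>Solutions of n a + k j = N with a odd\<close>

text \<open>The series q^n/(1-q^n)^2 gives each solution the weight \<open>a\<close>; modulo 2 only
  odd \<open>a\<close> survive.\<close>

definition weighted_solutions ::
    "(nat \<Rightarrow> nat \<Rightarrow> bool) \<Rightarrow> nat \<Rightarrow> (nat \<times> nat \<times> nat \<times> nat) set" where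
  "weighted_solutions Q N = {(n, a, k, j). 0 < n \<and> odd a \<and> Q n k \<and> 0 < j \<and> n * a + k * j = N}"

lemma finite_weighted_solutions:
  assumes "\<And>n k. Q n k \<Longrightarrow> n < k"
  shows "finite (weighted_solutions Q N)"
proof (rule finite_subset)
  show "weighted_solutions Q N \<subseteq> products_sum 1 1 N"
    using assms by (force simp: weighted_solutions_def products_sum_def odd_pos)
qed (rule finite_products_sum, auto)

text \<open>Splitting \<open>k = n + r\<close> turns \<open>n a + k j\<close> into \<open>n (a + j) + r j\<close>, where exactly one of
  \<open>a + j\<close> and \<open>j\<close> is odd; the inverse recovers which of the two was larger.\<close>

lemma card_weighted_solutions_less:
  "card (weighted_solutions (<) N) = card {(n, M, r, s) \<in> products_sum 1 2 N. odd M}"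
proof -
  let ?f = "\<lambda>(n, a, k, j). if odd (a + j) then (n, a + j, k - n, j div 2)
                           else (k - n, j, n, (a + j) div 2)"
  let ?g = "\<lambda>(n, M, r, s). if 2 * s < M then (n, M - 2 * s, n + r, 2 * s)
                           else (r, 2 * s - M, r + n, M :: nat)"
  let ?S = "weighted_solutions (<) N"
  let ?T = "{(n, M, r, s) \<in> products_sum 1 2 N. odd M}"
  have f: "?f p \<in> ?T \<and> ?g (?f p) = p" if "p \<in> ?S" for p
  proof -
    obtain n a k j where p: "p = (n, a, k, j)" by (cases p)
    from that have *: "0 < n" "odd a" "n < k" "0 < j" "n * a + k * j = N"
      by (auto simp: weighted_solutions_def p)
    from \<open>n < k\<close> obtain r where r: "k = n + r" "0 < r" using less_imp_add_positive by blast
    have "0 < a" using * by (simp add: odd_pos)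
    show ?thesis
    proof (cases "even j")
      case True
      then obtain s where "j = 2 * s" by blast
      then show ?thesis using * r \<open>0 < a\<close>
        by (auto simp: p products_sum_def algebra_simps)
    next
      case False
      then obtain s where "a + j = 2 * s" using * by (meson even_add evenE)
      then have "(a + j) div 2 = s" "s * 2 = a + j" by simp_all
      then show ?thesis using * r \<open>0 < a\<close> False
        by (auto simp: p products_sum_def algebra_simps)
    qed
  qed
  have g: "?g p \<in> ?S \<and> ?f (?g p) = p" if "p \<in> ?T" for p
  proof -
    obtain n M r s where p: "p = (n, M, r, s)" by (cases p)
    from that have *: "0 < n" "0 < M" "odd M" "0 < r" "0 < s" "n * M + 2 * r * s = N"
      by (auto simp: products_sum_def p)
    show ?thesis
    proof (cases "2 * s < M")
      case True
      then obtain a where "M = 2 * s + a" using less_imp_add_positive by blast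
      then show ?thesis using * True by (auto simp: p weighted_solutions_def algebra_simps)
    next
      case False
      then obtain a where a: "2 * s = M + a" by (metis le_add_diff_inverse not_less)
      have "2 * r * s = r * (M + a)" using a by (metis mult.assoc mult.commute)
      \<comment> \<open>Since \<open>M\<close> is odd, \<open>2 * s = M\<close> is impossible; so
        \<open>a\<close> is positive and the comparison in \<open>?g\<close> really separates the
        two cases of \<open>?f\<close>.\<close>
      moreover have "odd a" using a \<open>odd M\<close> by (metis even_add even_mult_iff even_numeral)
      ultimately show ?thesis using * a False
        by (auto simp: p weighted_solutions_def algebra_simps)
    qed
  qed
  show ?thesis by (rule card_eq_if_inverse[where f = ?f and g = ?g]) (rule f g, assumption)+
qed

text \<open>The condition that \<open>M\<close> is odd is removed by complement:
  \<open>M = 2 * M'\<close> turns the solutions with even \<open>M\<close> into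
  \<open>products_sum 2 2 N\<close>. Both full counts are then reduced to squares.\<close>

lemma even_card_weighted_solutions_less_iff:
  "even (card (weighted_solutions (<) N)) \<longleftrightarrow>
    even (card (squares_sum 1 2 N) + card (squares_sum 2 2 N))"
proof -
  let ?A = "products_sum 1 2 N" and ?h = "\<lambda>(n, M, r, s). (n, 2 * M, r, s :: nat) :: nat \<times> nat \<times> nat \<times> nat"
  let ?O = "{(n, M, r, s) \<in> ?A. odd M}"
  have "?A = ?O \<union> ?h ` products_sum 2 2 N"
  proof (intro equalityI subsetI)
    fix p assume "p \<in> ?A"
    obtain n M r s where p: "p = (n, M, r, s)" by (cases p)
    show "p \<in> ?O \<union> ?h ` products_sum 2 2 N"
    proof (cases "odd M")
      case False
      then obtain M' where "M = 2 * M'" by blast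
      then have "p = ?h (n, M', r, s)" "(n, M', r, s) \<in> products_sum 2 2 N"
        using \<open>p \<in> ?A\<close> by (auto simp: products_sum_def p algebra_simps)
      then show ?thesis by blast
    qed (use p \<open>p \<in> ?A\<close> in auto)
  qed (auto simp: products_sum_def algebra_simps)
  moreover have "?O \<inter> ?h ` products_sum 2 2 N = {}" by auto
  moreover have "finite ?A" "finite (products_sum 2 2 N)" by (auto intro!: finite_products_sum)
  ultimately have "card ?A = card ?O + card (?h ` products_sum 2 2 N)"
    by (metis (no_types, lifting) card_Un_disjoint finite_Un)
  also have "card (?h ` products_sum 2 2 N) = card (products_sum 2 2 N)"
    by (rule card_image) (auto simp: inj_on_def)
  finally have "even (card ?O) \<longleftrightarrow> even (card ?A + card (products_sum 2 2 N))" by presburger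
  then show ?thesis
    using even_card_products_sum_iff[of 1 2 N] even_card_products_sum_iff[of 2 2 N]
    by (simp add: card_weighted_solutions_less)
qed

section \<open>Factorizations and the solutions with odd k > 2 n\<close>

definition square_roots :: "nat \<Rightarrow> nat \<Rightarrow> nat set" where
  "square_roots c N = {z. 0 < z \<and> c * z\<^sup>2 = N}"

definition factorizations :: "nat \<Rightarrow> nat \<Rightarrow> (nat \<times> nat) set" where
  "factorizations c N = {(u, v). 0 < u \<and> 0 < v \<and> c * u * v = N}"

lemma finite_factorizations:
  assumes "0 < c"
  shows "finite (factorizations c N)"
proof (rule finite_subset)
  show "factorizations c N \<subseteq> {..N} \<times> {..N}"
  proof
    fix p assume "p \<in> factorizations c N"
    then show "p \<in> {..N} \<times> {..N}"
      using le_if_mult_eq[OF assms, of "fst p" "snd p" N]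
      by (simp add: factorizations_def case_prod_beta mem_Times_iff)
  qed
qed auto

lemma even_card_factorizations_iff:
  assumes "0 < c"
  shows "even (card (factorizations c N)) \<longleftrightarrow> even (card (square_roots c N))"
proof -
  let ?S = "factorizations c N" and ?f = "\<lambda>(u, v). (v, u) :: nat \<times> nat"
  have "even (card ?S) \<longleftrightarrow> even (card {p \<in> ?S. ?f p = p})"
    by (rule even_card_involution_iff[OF finite_factorizations[OF assms]])
      (auto simp: factorizations_def mult_ac)
  also have "{p \<in> ?S. ?f p = p} = (\<lambda>z. (z, z)) ` square_roots c N"
    by (auto simp: factorizations_def square_roots_def power2_eq_square mult.assoc image_iff)
  also have "card \<dots> = card (square_roots c N)"
    by (rule card_image) (auto simp: inj_on_def)
  finally show ?thesis .
qed

text \<open>As \<open>a\<close> is odd, exactly one of \<open>n\<close> and \<open>n + a\<close> is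
  even. Halving it gives \<open>u\<close>, and the other one is \<open>v\<close>. Conversely, the
  smaller of \<open>2 * u\<close> and \<open>v\<close> is \<open>n\<close>.\<close>

lemma card_factorizations_odd:
  "card {(n, a). 0 < n \<and> odd a \<and> 2 * n * (n + a) = N} = card {(u, v) \<in> factorizations 4 N. odd v}"
proof -
  let ?f = "\<lambda>(n, a). if even n then (n div 2, n + a) else ((n + a) div 2, n)"
  let ?g = "\<lambda>(u, v). if 2 * u < v then (2 * u, v - 2 * u) else (v, 2 * u - v :: nat)"
  let ?S = "{(n, a). 0 < n \<and> odd a \<and> 2 * n * (n + a) = N}"
  let ?T = "{(u, v) \<in> factorizations 4 N. odd v}"
  have f: "?f p \<in> ?T \<and> ?g (?f p) = p" if "p \<in> ?S" for p
  proof -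
    obtain n a where p: "p = (n, a)" by (cases p)
    from that have *: "0 < n" "odd a" "2 * n * (n + a) = N" by (auto simp: p)
    have "0 < a" using * by (simp add: odd_pos)
    show ?thesis
    proof (cases "even n")
      case True
      then obtain s where "n = 2 * s" by blast
      then show ?thesis using * \<open>0 < a\<close>
        by (auto simp: p factorizations_def algebra_simps)
    next
      case False
      then obtain s where s: "n + a = 2 * s" using * by (meson even_add evenE)
      then have "2 * n * (2 * s) = N" using * by simp
      with s show ?thesis using * \<open>0 < a\<close> False
        by (auto simp: p factorizations_def algebra_simps)
    qed
  qed
  have g: "?g p \<in> ?S \<and> ?f (?g p) = p" if "p \<in> ?T" for p
  proof -
    obtain u v where p: "p = (u, v)" by (cases p)
    from that have *: "0 < u" "0 < v" "odd v" "4 * u * v = N" by (auto simp: factorizations_def p)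
    show ?thesis
    proof (cases "2 * u < v")
      case True
      then obtain a where "v = 2 * u + a" using less_imp_add_positive by blast
      then show ?thesis using * True by (auto simp: p algebra_simps)
    next
      case False
      then obtain a where a: "2 * u = v + a" by (metis le_add_diff_inverse not_less)
      have "odd a" using a \<open>odd v\<close> by (metis even_add even_mult_iff even_numeral)
      moreover have "2 * v * (v + a) = N" using * a by (metis mult.assoc mult.commute mult_2 numeral_Bit0)
      ultimately show ?thesis using * a False by (auto simp: p)
    qed
  qed
  show ?thesis by (rule card_eq_if_inverse[where f = ?f and g = ?g]) (rule f g, assumption)+
qed

text \<open>With \<open>k = 2 * n + r\<close> the sum becomes
  \<open>n * a + 2 * n * j + r * j\<close>, where \<open>r\<close> is odd; it is symmetric under
  exchanging \<open>(n, a)\<close> with \<open>(j, r)\<close>.\<close>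

lemma even_card_weighted_solutions_odd_iff:
  "even (card (weighted_solutions (\<lambda>n k. odd k \<and> 2 * n < k) N)) \<longleftrightarrow>
    even (card (square_roots 4 N) + card (square_roots 8 N))"
proof -
  let ?S = "weighted_solutions (\<lambda>n k. odd k \<and> 2 * n < k) N"
  let ?f = "\<lambda>(n, a, k, j). (j, k - 2 * n, a + 2 * j, n) :: nat \<times> nat \<times> nat \<times> nat"
  let ?F = "{(n, a). 0 < n \<and> odd a \<and> 2 * n * (n + a) = N}"
  have "?f p \<in> ?S \<and> ?f (?f p) = p" if "p \<in> ?S" for p
  proof -
    obtain n a k j where p: "p = (n, a, k, j)" by (cases p)
    from that have *: "0 < n" "odd a" "odd k" "2 * n < k" "0 < j" "n * a + k * j = N"
      by (auto simp: weighted_solutions_def p)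
    then obtain r where "k = 2 * n + r" "0 < r" using less_imp_add_positive by blast
    then show ?thesis using * by (auto simp: p weighted_solutions_def algebra_simps odd_pos)
  qed
  then have "even (card ?S) \<longleftrightarrow> even (card {p \<in> ?S. ?f p = p})"
    by (intro even_card_involution_iff finite_weighted_solutions) auto
  \<comment> \<open>A fixed point has \<open>j = n\<close> and \<open>k = a + 2 * n\<close>, so the
    equation reads \<open>2 * n * (n + a) = N\<close>.\<close>
  also have "{p \<in> ?S. ?f p = p} = (\<lambda>(n, a). (n, a, a + 2 * n, n)) ` ?F"
    by (auto simp: weighted_solutions_def algebra_simps image_iff odd_pos)
  also have "card \<dots> = card ?F"
    by (rule card_image) (auto simp: inj_on_def)
  also have "\<dots> = card {(u, v) \<in> factorizations 4 N. odd v}" (is "_ = card ?O")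
    by (rule card_factorizations_odd)
  finally have 1: "even (card ?S) \<longleftrightarrow> even (card ?O)" .
  let ?A = "factorizations 4 N" and ?h = "\<lambda>(u, v). (u, 2 * v) :: nat \<times> nat"
  \<comment> \<open>Odd \<open>v\<close> is again handled by complement: an even
    \<open>v = 2 * v'\<close> turns \<open>4 * u * v\<close> into \<open>8 * u * v'\<close>.\<close>
  have "?A = ?O \<union> ?h ` factorizations 8 N"
  proof (intro equalityI subsetI)
    fix p assume "p \<in> ?A"
    obtain u v where p: "p = (u, v)" by (cases p)
    show "p \<in> ?O \<union> ?h ` factorizations 8 N"
    proof (cases "odd v")
      case False
      then obtain v' where "v = 2 * v'" by blast
      then have "p = ?h (u, v')" "(u, v') \<in> factorizations 8 N"
        using \<open>p \<in> ?A\<close> by (auto simp: factorizations_def p algebra_simps)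
      then show ?thesis by blast
    qed (use p \<open>p \<in> ?A\<close> in auto)
  qed (auto simp: factorizations_def algebra_simps)
  moreover have "?O \<inter> ?h ` factorizations 8 N = {}" by auto
  moreover have "finite ?A" "finite (factorizations 8 N)" by (auto intro!: finite_factorizations)
  ultimately have "card ?A = card ?O + card (?h ` factorizations 8 N)"
    by (metis (no_types, lifting) card_Un_disjoint finite_Un)
  also have "card (?h ` factorizations 8 N) = card (factorizations 8 N)"
    by (rule card_image) (auto simp: inj_on_def)
  finally have "even (card ?O) \<longleftrightarrow> even (card ?A + card (factorizations 8 N))" by presburger
  then show ?thesis
    using 1 even_card_factorizations_iff[of 4 N] even_card_factorizations_iff[of 8 N] by simp
qed

text \<open>The restriction on \<open>k\<close> comes from \<open>sptbar_omega\<close>, which allows all \<open>k\<close> with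
  \<open>n < k \<le> 2 n\<close> and only the even \<open>k > 2 n\<close>.\<close>

lemma card_weighted_solutions_split:
  "card (weighted_solutions (<) N) =
    card (weighted_solutions (\<lambda>n k. n < k \<and> (k \<le> 2 * n \<or> even k)) N) +
    card (weighted_solutions (\<lambda>n k. odd k \<and> 2 * n < k) N)"
proof (subst card_Un_disjoint[symmetric])
  show "card (weighted_solutions (<) N) =
    card (weighted_solutions (\<lambda>n k. n < k \<and> (k \<le> 2 * n \<or> even k)) N \<union>
      weighted_solutions (\<lambda>n k. odd k \<and> 2 * n < k) N)"
    by (rule arg_cong[of _ _ card]) (auto simp: weighted_solutions_def)
next
  show "weighted_solutions (\<lambda>n k. n < k \<and> (k \<le> 2 * n \<or> even k)) N \<inter>
      weighted_solutions (\<lambda>n k. odd k \<and> 2 * n < k) N = {}"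
    by (auto simp: weighted_solutions_def)
qed (auto intro!: finite_weighted_solutions)

section \<open>Descent by 7 for the quadratic forms\<close>

lemma square_mod_7_cases:
  fixes x :: nat
  shows "x\<^sup>2 mod 7 = 0 \<and> 7 dvd x \<or> x\<^sup>2 mod 7 = 1 \<or> x\<^sup>2 mod 7 = 2 \<or> x\<^sup>2 mod 7 = 4"
proof -
  have "x mod 7 < 7" by simp
  then have "x mod 7 \<in> {0, 1, 2, 3, 4, 5, 6}" by auto
  moreover have "x\<^sup>2 mod 7 = (x mod 7)\<^sup>2 mod 7" by (simp add: power_mod)
  ultimately show ?thesis by (auto simp: power2_eq_square)
qed

lemma binary_form_mod_7:
  fixes x y c :: nat
  assumes "7 dvd c * x\<^sup>2 + 2 * y\<^sup>2" and "c = 1 \<or> c = 2"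
  shows "7 dvd x \<and> 7 dvd y"
proof -
  \<comment> \<open>A finite check over the possible residues \<open>A\<close>, \<open>B\<close> of
    the two squares; it expresses that -2 (for \<open>c = 1\<close>) and -1 (for
    \<open>c = 2\<close>) are non-residues modulo 7.\<close>
  have *: "A = 0 \<and> B = 0"
    if "(c * A + 2 * B) mod 7 = 0" "A \<in> {0, 1, 2, 4}" "B \<in> {0, 1, 2, 4}" for A B :: nat
    using that assms(2) by auto presburger+
  have "(c * (x\<^sup>2 mod 7) + 2 * (y\<^sup>2 mod 7)) mod 7 = (c * x\<^sup>2 + 2 * y\<^sup>2) mod 7"
    by (intro mod_add_cong mod_mult_cong refl) simp_all
  also have "\<dots> = 0" using assms(1) by (rule dvd_imp_mod_0)
  finally have "x\<^sup>2 mod 7 = 0 \<and> y\<^sup>2 mod 7 = 0"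
    by (rule *) (use square_mod_7_cases in blast)+
  then show ?thesis using square_mod_7_cases[of x] square_mod_7_cases[of y] by presburger
qed

text \<open>The counterpart of \<open>at_div7\<close> for values in the natural numbers. At
  \<open>N = 0\<close> it returns \<open>f 0\<close>; for positive arguments the conventions
  coincide.\<close>

definition at_quotient_7 :: "(nat \<Rightarrow> nat) \<Rightarrow> nat \<Rightarrow> nat" where
  "at_quotient_7 f N = (if 7 dvd N then f (N div 7) else 0)"

text \<open>Both variables are multiples of 7, so the form is a multiple of 49. This forces 7 to
  divide \<open>N\<close>, and dividing the variables by 7 maps the solutions bijectively to those
  for \<open>N div 7\<close>.\<close>

lemma card_squares_sum_mult_7:
  assumes "c = 1 \<or> c = 2"
  shows "card (squares_sum c 2 (7 * N)) = at_quotient_7 (\<lambda>N. card (squares_sum c 2 N)) N"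
proof -
  have div7: "\<exists>u v. x = 7 * u \<and> y = 7 * v \<and> 7 * (c * u\<^sup>2 + 2 * v\<^sup>2) = N"
    if "c * x\<^sup>2 + 2 * y\<^sup>2 = 7 * N" for x y
  proof -
    have "7 dvd x \<and> 7 dvd y" using that by (intro binary_form_mod_7[OF _ assms]) simp
    then obtain u v where "x = 7 * u" "y = 7 * v" by blast
    then show ?thesis using that by (auto simp: power2_eq_square algebra_simps)
  qed
  show ?thesis
  proof (cases "7 dvd N")
    case True
    then obtain N' where N': "N = 7 * N'" by blast
    have "squares_sum c 2 (7 * N) = (\<lambda>(u, v). (7 * u, 7 * v)) ` squares_sum c 2 N'"
    proof (intro equalityI subsetI)
      fix p assume "p \<in> squares_sum c 2 (7 * N)"
      then show "p \<in> (\<lambda>(u, v). (7 * u, 7 * v)) ` squares_sum c 2 N'"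
        using div7 N' by (fastforce simp: squares_sum_def)
    qed (auto simp: squares_sum_def N' power2_eq_square algebra_simps)
    moreover have "card \<dots> = card (squares_sum c 2 N')"
      by (rule card_image) (auto simp: inj_on_def)
    ultimately show ?thesis by (simp add: at_quotient_7_def N')
  next
    case False
    then have "squares_sum c 2 (7 * N) = {}" using div7 by (fastforce simp: squares_sum_def)
    then show ?thesis using False by (simp add: at_quotient_7_def)
  qed
qed

lemma card_square_roots_mult_7:
  assumes "c = 4 \<or> c = 8"
  shows "card (square_roots c (7 * N)) = at_quotient_7 (\<lambda>N. card (square_roots c N)) N"
proof -
  have div7: "\<exists>u. z = 7 * u \<and> 7 * (c * u\<^sup>2) = N" if "c * z\<^sup>2 = 7 * N" for z
  proof -
    have "7 dvd c * z\<^sup>2" using that by simp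
    moreover have prime_7: "prime (7 :: nat)" by simp
    ultimately have "7 dvd c \<or> 7 dvd z\<^sup>2" by (simp only: prime_dvd_mult_iff)
    moreover have "\<not> 7 dvd c" using assms by auto
    ultimately have "7 dvd z" using prime_7 prime_dvd_power by blast
    then obtain u where "z = 7 * u" by blast
    then show ?thesis using that by (auto simp: power2_eq_square algebra_simps)
  qed
  show ?thesis
  proof (cases "7 dvd N")
    case True
    then obtain N' where N': "N = 7 * N'" by blast
    have "square_roots c (7 * N) = (*) 7 ` square_roots c N'"
    proof (intro equalityI subsetI)
      fix z assume z: "z \<in> square_roots c (7 * N)"
      then obtain u where "z = 7 * u" "7 * (c * u\<^sup>2) = N"
        using div7 by (auto simp: square_roots_def)
      then show "z \<in> (*) 7 ` square_roots c N'"
        using z N' by (auto simp: square_roots_def)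
    qed (auto simp: square_roots_def N' power2_eq_square algebra_simps)
    moreover have "card \<dots> = card (square_roots c N')"
      by (rule card_image) (auto simp: inj_on_def)
    ultimately show ?thesis by (simp add: at_quotient_7_def N')
  next
    case False
    then have "square_roots c (7 * N) = {}"
      using div7 by (auto simp: square_roots_def) (metis dvd_triv_left)
    then show ?thesis using False by (simp add: at_quotient_7_def)
  qed
qed

lemma even_card_weighted_solutions_less_mult_7:
  "even (card (weighted_solutions (<) (7 * N))) \<longleftrightarrow>
    even (at_quotient_7 (\<lambda>N. card (weighted_solutions (<) N)) N)"
proof -
  have "card (squares_sum 1 2 (7 * N)) = at_quotient_7 (\<lambda>N. card (squares_sum 1 2 N)) N"
    "card (squares_sum 2 2 (7 * N)) = at_quotient_7 (\<lambda>N. card (squares_sum 2 2 N)) N"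
    by (rule card_squares_sum_mult_7, simp)+
  then show ?thesis
    using even_card_weighted_solutions_less_iff[of "7 * N"]
      even_card_weighted_solutions_less_iff[of "N div 7"]
    by (cases "7 dvd N") (simp_all only: at_quotient_7_def if_True if_False even_zero even_add simp_thms)
qed

text \<open>The count for \<open>Q\<close> is the count for \<open>(<)\<close> minus that for the
  complementary \<open>R\<close>; modulo 2 the difference is a sum, and each summand is already
  known to descend.\<close>

lemma even_card_weighted_solutions_omega_mult_7:
  fixes Q :: "nat \<Rightarrow> nat \<Rightarrow> bool"
  defines "Q \<equiv> \<lambda>n k. n < k \<and> (k \<le> 2 * n \<or> even k)"
  shows "even (card (weighted_solutions Q (7 * N))) \<longleftrightarrow>
    even (at_quotient_7 (\<lambda>N. card (weighted_solutions Q N)) N)"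
proof -
  define R where "R = (\<lambda>n k :: nat. odd k \<and> 2 * n < k)"
  have "even (card (weighted_solutions Q N)) \<longleftrightarrow>
      even (card (weighted_solutions (<) N) + card (weighted_solutions R N))" for N
    using card_weighted_solutions_split[of N] unfolding Q_def R_def by presburger
  moreover have "even (card (weighted_solutions R (7 * N))) \<longleftrightarrow>
      even (at_quotient_7 (\<lambda>N. card (weighted_solutions R N)) N)"
  proof -
    have "card (square_roots 4 (7 * N)) = at_quotient_7 (\<lambda>N. card (square_roots 4 N)) N"
      "card (square_roots 8 (7 * N)) = at_quotient_7 (\<lambda>N. card (square_roots 8 N)) N"
      by (rule card_square_roots_mult_7, simp)+
    then show ?thesis
      using even_card_weighted_solutions_odd_iff[of "7 * N"]
        even_card_weighted_solutions_odd_iff[of "N div 7"]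
      unfolding R_def
      by (cases "7 dvd N") (simp_all only: at_quotient_7_def if_True if_False even_zero even_add simp_thms)
  qed
  ultimately show ?thesis
    using even_card_weighted_solutions_less_mult_7[of N] by (cases "7 dvd N") (simp_all add: at_quotient_7_def)
qed

text \<open>Inclusion-exclusion: the divisors of \<open>7 * N\<close> are those of \<open>N\<close>
  together with their multiples by 7, and the overlap is 7 times the divisors of
  \<open>N div 7\<close>, or empty if 7 does not divide \<open>N\<close>.\<close>

lemma sum_divisors_mult_7:
  fixes N :: nat
  assumes "0 < N"
  shows "\<Sum>{d. d dvd 7 * N} + 7 * at_quotient_7 (\<lambda>N. \<Sum>{d. d dvd N}) N = 8 * \<Sum>{d. d dvd N}"
proof -
  let ?D = "\<lambda>N. {d :: nat. d dvd N}"
  have "d dvd N \<or> (\<exists>e. d = 7 * e \<and> e dvd N)" if "d dvd 7 * N" for d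
  proof (cases "7 dvd d")
    case False
    have "prime (7 :: nat)" by simp
    then have "coprime d 7" using False prime_imp_coprime coprime_commute by blast
    then show ?thesis using that coprime_dvd_mult_right_iff by blast
  qed (use that in auto)
  then have union: "?D (7 * N) = ?D N \<union> (*) 7 ` ?D N" by (auto intro: dvd_mult)
  have "?D N \<inter> (*) 7 ` ?D N = (if 7 dvd N then (*) 7 ` ?D (N div 7) else {})"
  proof (cases "7 dvd N")
    case True
    then obtain N' where "N = 7 * N'" by blast
    then show ?thesis by auto
  next
    case False
    then show ?thesis by (auto dest: dvd_mult_left)
  qed
  moreover have "\<Sum>((*) 7 ` A) = 7 * \<Sum>A" for A :: "nat set"
    by (subst sum.reindex) (auto simp: inj_on_def sum_distrib_left)
  moreover have "finite (?D N)" using assms by simp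
  moreover have "\<Sum>(?D N \<union> (*) 7 ` ?D N) + \<Sum>(?D N \<inter> (*) 7 ` ?D N) = \<Sum>(?D N) + \<Sum>((*) 7 ` ?D N)"
    using \<open>finite (?D N)\<close> by (intro sum.union_inter) auto
  ultimately show ?thesis by (simp add: union at_quotient_7_def split: if_splits)
qed

section \<open>Generating functions modulo 4\<close>

unbundle fps_syntax

section \<open>Power series up to a given degree\<close>

text \<open>Congruence modulo q^(m+1); it allows infinite sums and products to be replaced by finite
  ones when a single coefficient is computed.\<close>

definition agree_upto :: "nat \<Rightarrow> rat fps \<Rightarrow> rat fps \<Rightarrow> bool" where
  "agree_upto m F G \<longleftrightarrow> (\<forall>i\<le>m. F $ i = G $ i)"

lemma agree_upto_refl [simp]: "agree_upto m F F"
  by (simp add: agree_upto_def)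

lemma agree_upto_mult:
  "agree_upto m F G \<Longrightarrow> agree_upto m F' G' \<Longrightarrow> agree_upto m (F * F') (G * G')"
  by (auto simp: agree_upto_def fps_mult_nth intro!: sum.cong)

lemma agree_upto_sum:
  "(\<And>x. x \<in> A \<Longrightarrow> agree_upto m (F x) (G x)) \<Longrightarrow> agree_upto m (sum F A) (sum G A)"
  by (auto simp: agree_upto_def fps_sum_nth intro!: sum.cong)

lemma agree_upto_inverse:
  assumes "agree_upto m F G" and "F $ 0 \<noteq> 0"
  shows "agree_upto m (inverse F) (inverse G)"
proof -
  have "G $ 0 \<noteq> 0" using assms by (auto simp: agree_upto_def)
  \<comment> \<open>The two sides simplify to \<open>inverse F\<close> and \<open>inverse G\<close>,
    and they differ only in the last factor, where \<open>G\<close> agrees with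
    \<open>F\<close>.\<close>
  have "agree_upto m (inverse F * (inverse G * G)) (inverse F * (inverse G * F))"
    by (intro agree_upto_mult) (use assms(1) in \<open>auto simp: agree_upto_def\<close>)
  moreover have "inverse F * (inverse G * G) = inverse F"
    using \<open>G $ 0 \<noteq> 0\<close> by (simp add: inverse_mult_eq_1)
  moreover have "inverse F * (inverse G * F) = inverse G"
    using inverse_mult_eq_1[OF assms(2)] by (metis mult.assoc mult.commute mult.right_neutral)
  ultimately show ?thesis by simp
qed

text \<open>Coefficient \<open>i\<close> no longer changes from index \<open>i\<close> on, so the
  limit is the diagonal series with coefficients \<open>f i $ i\<close>.\<close>

lemma agree_upto_lim:
  fixes f :: "nat \<Rightarrow> rat fps"
  assumes "\<And>N. agree_upto N (f (Suc N)) (f N)"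
  shows "agree_upto m (lim f) (f m)"
proof -
  have stable: "f N $ i = f i $ i" if "i \<le> N" for i N
    using that assms by (induction rule: dec_induct) (auto simp: agree_upto_def)
  have "f \<longlonglongrightarrow> Abs_fps (\<lambda>i. f i $ i)"
    by (rule tendsto_fpsI) (auto simp: eventually_at_top_linorder intro: stable)
  then have "lim f = Abs_fps (\<lambda>i. f i $ i)" by (rule limI)
  then show ?thesis by (auto simp: agree_upto_def intro: stable[symmetric])
qed

lemma qpoch_nth_0: "a $ 0 = 0 \<Longrightarrow> qpoch a q N $ 0 = 1"
  by (induction N) (simp_all add: qpoch_def)

lemma agree_upto_qpoch_inf:
  assumes "a $ 0 = 0" and "0 < t"
  shows "agree_upto m (qpoch_inf a (fps_X ^ t)) (qpoch a (fps_X ^ t) m)"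
  unfolding qpoch_inf_def
proof (rule agree_upto_lim)
  fix N
  have "qpoch a (fps_X ^ t) (Suc N) =
      qpoch a (fps_X ^ t) N - fps_X ^ (t * N) * (qpoch a (fps_X ^ t) N * a)"
    by (simp only: qpoch_def prod.lessThan_Suc power_mult) (simp add: algebra_simps)
  \<comment> \<open>The new factor changes no coefficient below \<open>t * N\<close>; at
    \<open>t * N\<close> itself the change is the constant term of a multiple of \<open>a\<close>,
    which is zero.\<close>
  moreover have "i < t * N \<or> i = t * N" if "i \<le> N" for i
    using that mult_le_mono1[of 1 t N] assms(2) by linarith
  ultimately show "agree_upto N (qpoch a (fps_X ^ t) (Suc N)) (qpoch a (fps_X ^ t) N)"
    using assms(1) by (fastforce simp: agree_upto_def fps_X_power_mult_nth)
qed

section \<open>Series expansions of the individual factors\<close>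

text \<open>The series q^k/(1-q^k) for positive \<open>k\<close>.\<close>

definition geometric_fps :: "nat \<Rightarrow> rat fps" where
  "geometric_fps k = Abs_fps (\<lambda>i. if 0 < i \<and> k dvd i then 1 else 0)"

text \<open>The series q^n/(1-q^n)^2, the sum of a q^(na) over a, for positive
  \<open>n\<close>.\<close>

definition quotient_fps :: "nat \<Rightarrow> rat fps" where
  "quotient_fps n = Abs_fps (\<lambda>i. if n dvd i then of_nat (i div n) else 0)"

lemma geometric_fps_eq:
  assumes "0 < k"
  shows "(1 - fps_X ^ k) * geometric_fps k = fps_X ^ k"
proof (rule fps_ext)
  fix i
  have "k dvd i - k \<longleftrightarrow> k dvd i" if "k \<le> i"
    using that by (metis dvd_minus_self le_add_diff_inverse2 dvd_add_triv_right_iff)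
  then show "((1 - fps_X ^ k) * geometric_fps k) $ i = fps_X ^ k $ i"
    using assms by (auto simp: left_diff_distrib fps_X_power_mult_nth geometric_fps_def dest: dvd_imp_le)
qed

lemma quotient_fps_eq:
  assumes "0 < n"
  shows "(1 - fps_X ^ n)\<^sup>2 * quotient_fps n = fps_X ^ n"
proof -
  \<comment> \<open>One factor takes differences of successive coefficients, a - (a-1) = 1.\<close>
  have "(1 - fps_X ^ n) * quotient_fps n = geometric_fps n"
  proof (rule fps_ext)
    fix i
    show "((1 - fps_X ^ n) * quotient_fps n) $ i = geometric_fps n $ i"
    proof (cases "i < n")
      case True
      then show ?thesis using assms
        by (auto simp: left_diff_distrib fps_X_power_mult_nth quotient_fps_def geometric_fps_def dest: dvd_imp_le)
    next
      case False
      then obtain l where "i = l + n" by (metis le_add_diff_inverse2 not_less)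
      then show ?thesis using assms
        by (auto simp: left_diff_distrib fps_X_power_mult_nth quotient_fps_def geometric_fps_def)
    qed
  qed
  then show ?thesis using geometric_fps_eq[OF assms] by (simp add: power2_eq_square mult.assoc)
qed

text \<open>Factor by factor, 1 + x = (1 - x)(1 + 2x/(1 - x)).\<close>

lemma qpoch_uminus_eq:
  assumes "0 < s"
  shows "qpoch (- (fps_X ^ s)) (fps_X ^ t) N =
    qpoch (fps_X ^ s) (fps_X ^ t) N * (\<Prod>j<N. 1 + 2 * geometric_fps (s + t * j))"
  unfolding qpoch_def prod.distrib[symmetric]
proof (rule prod.cong)
  fix j
  let ?x = "fps_X ^ (s + t * j) :: rat fps" and ?y = "geometric_fps (s + t * j)"
  have "(1 - ?x) * (1 + 2 * ?y) = 1 - ?x + 2 * ((1 - ?x) * ?y)" by (simp add: algebra_simps)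
  also have "\<dots> = 1 + ?x" using geometric_fps_eq[of "s + t * j"] assms by simp
  finally show "1 - - (fps_X ^ s) * (fps_X ^ t) ^ j =
      (1 - fps_X ^ s * (fps_X ^ t) ^ j) * (1 + 2 * ?y)"
    by (simp add: power_add power_mult)
qed simp

text \<open>Here \<open>Q\<close> stands for the Pochhammer product in the denominator; it cancels
  against the same factor split off from the numerator by \<open>qpoch_uminus_eq\<close>.\<close>

lemma quotient_term_eq:
  assumes "0 < n" and "Q $ 0 = 1"
  shows "fps_X ^ n * (Q * R) * inverse ((1 - fps_X ^ n)\<^sup>2 * Q) = quotient_fps n * R"
proof -
  let ?D = "(1 - fps_X ^ n)\<^sup>2 * Q"
  have "?D $ 0 \<noteq> 0" using assms by (simp add: power2_eq_square)
  then have "?D * inverse ?D = 1" by (rule inverse_mult_eq_1')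
  moreover have "fps_X ^ n * (Q * R) = (1 - fps_X ^ n)\<^sup>2 * quotient_fps n * (Q * R)"
    by (simp only: quotient_fps_eq[OF assms(1)])
  then have "fps_X ^ n * (Q * R) = quotient_fps n * R * ?D" by (simp only: mult_ac)
  ultimately show ?thesis by (simp only: mult.assoc[of "quotient_fps n * R"] mult_1_right)
qed

section \<open>Integrality and expansion modulo 4\<close>

definition integral_fps :: "rat fps \<Rightarrow> bool" where
  "integral_fps F \<longleftrightarrow> (\<forall>i. F $ i \<in> \<int>)"

lemma integral_fps_add: "integral_fps F \<Longrightarrow> integral_fps G \<Longrightarrow> integral_fps (F + G)"
  by (simp add: integral_fps_def)

lemma integral_fps_mult: "integral_fps F \<Longrightarrow> integral_fps G \<Longrightarrow> integral_fps (F * G)"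
  by (auto simp: integral_fps_def fps_mult_nth intro!: Ints_sum Ints_mult)

lemma integral_fps_sum: "(\<And>x. x \<in> A \<Longrightarrow> integral_fps (F x)) \<Longrightarrow> integral_fps (sum F A)"
  by (auto simp: integral_fps_def fps_sum_nth intro!: Ints_sum)

lemma integral_geometric_fps: "integral_fps (geometric_fps k)"
  by (simp add: integral_fps_def geometric_fps_def)

lemma integral_quotient_fps: "integral_fps (quotient_fps k)"
  by (simp add: integral_fps_def quotient_fps_def)

lemma prod_one_plus_double:
  assumes "finite A" and "\<And>k. k \<in> A \<Longrightarrow> integral_fps (F k)"
  shows "\<exists>E. integral_fps E \<and> (\<Prod>k\<in>A. 1 + 2 * F k) = 1 + 2 * (\<Sum>k\<in>A. F k) + 4 * E"
  using assms
proof (induction A rule: finite_induct)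
  case empty
  show ?case by (rule exI[of _ 0]) (simp add: integral_fps_def)
next
  case (insert k A)
  then obtain E where E: "integral_fps E" "(\<Prod>k\<in>A. 1 + 2 * F k) = 1 + 2 * (\<Sum>k\<in>A. F k) + 4 * E"
    by auto
  \<comment> \<open>Obtained by expanding (1 + 2 F)(1 + 2 S + 4 E) with S the sum over
    \<open>A\<close>; the coefficient 2 of \<open>F k * E\<close> is written as a repeated summand
    to keep integrality a matter of sums and products.\<close>
  let ?E = "E + F k * (\<Sum>k\<in>A. F k) + (F k * E + F k * E)"
  have "integral_fps ?E"
    using E insert.prems by (intro integral_fps_add integral_fps_mult integral_fps_sum) auto
  moreover have "(\<Prod>k\<in>insert k A. 1 + 2 * F k) = 1 + 2 * (\<Sum>k\<in>insert k A. F k) + 4 * ?E"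
    using insert.hyps E(2) by (simp add: algebra_simps)
  ultimately show ?case by blast
qed

text \<open>The reduction of \<open>quotient_fps n\<close> modulo 2 with coefficients 0 and
  1.\<close>

definition odd_quotient_fps :: "nat \<Rightarrow> rat fps" where
  "odd_quotient_fps n = Abs_fps (\<lambda>i. if n dvd i \<and> odd (i div n) then 1 else 0)"

lemma quotient_fps_split:
  "\<exists>V. integral_fps V \<and> quotient_fps n = odd_quotient_fps n + 2 * V"
proof (intro exI conjI)
  let ?V = "Abs_fps (\<lambda>i. if n dvd i then of_nat (i div n div 2) else 0) :: rat fps"
  show "integral_fps ?V" by (simp add: integral_fps_def)
  show "quotient_fps n = odd_quotient_fps n + 2 * ?V"
  proof (rule fps_ext)
    fix i
    have "(of_nat (i div n) :: rat) = of_nat (i div n mod 2 + 2 * (i div n div 2))"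
      by simp
    also have "\<dots> = of_nat (i div n mod 2) + 2 * of_nat (i div n div 2)"
      by (simp only: of_nat_add of_nat_mult of_nat_numeral)
    also have "\<dots> = (if odd (i div n) then 1 else 0) + 2 * of_nat (i div n div 2)"
      by (simp only: mod2_eq_if) simp
    finally show "quotient_fps n $ i = (odd_quotient_fps n + 2 * ?V) $ i"
      by (simp add: quotient_fps_def odd_quotient_fps_def numeral_fps_const)
  qed
qed

section \<open>Coefficients as divisor sums and solution counts\<close>

text \<open>A divisor \<open>n\<close> contributes its cofactor \<open>m div n\<close>, and passing
  to cofactors permutes the divisors.\<close>

lemma sum_quotient_fps_nth:
  assumes "0 < m"
  shows "(\<Sum>n = 1..m. quotient_fps n) $ m = of_nat (\<Sum>{d. d dvd m})"
proof -
  have "(\<Sum>n = 1..m. quotient_fps n) $ m = (\<Sum>n = 1..m. if n dvd m then of_nat (m div n) else 0)"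
    by (simp add: fps_sum_nth quotient_fps_def)
  also have "\<dots> = (\<Sum>n \<in> {d. d dvd m}. of_nat (m div n))"
    using assms by (intro sum.mono_neutral_cong_right) (auto dest: dvd_imp_le intro: Suc_leI dvd_pos_nat)
  also have "\<dots> = (\<Sum>d \<in> {d. d dvd m}. of_nat d)"
    using assms by (intro sum.reindex_bij_witness[where i = "(div) m" and j = "(div) m"]) auto
  finally show ?thesis by simp
qed

text \<open>\<open>K n\<close> is a finite part of the \<open>k\<close> with \<open>Q n k\<close>,
  coming from a truncated product. It contains every such \<open>k\<close> up to \<open>m\<close>,
  and no larger \<open>k\<close> can satisfy \<open>n * a + k * j = m\<close>.\<close>

lemma sum_odd_quotient_mult_geometric_nth:
  assumes less: "\<And>n k. Q n k \<Longrightarrow> n < k"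
    and K: "\<And>n. finite (K n)" "\<And>n k. k \<in> K n \<Longrightarrow> Q n k" "\<And>n k. Q n k \<Longrightarrow> k \<le> m \<Longrightarrow> k \<in> K n"
  shows "(\<Sum>n = 1..m. \<Sum>k\<in>K n. odd_quotient_fps n * geometric_fps k) $ m =
    of_nat (card (weighted_solutions Q m))"
proof -
  \<comment> \<open>\<open>i = n * a\<close> is the degree taken from the first factor and
    \<open>m - i = k * j\<close> that from the second; \<open>i < m\<close> because the geometric
    series has no constant term.\<close>
  let ?P = "\<lambda>(n, k, i). n dvd i \<and> odd (i div n) \<and> i < m \<and> k dvd m - i"
  let ?B = "SIGMA n:{1..m}. K n \<times> {0..m}"
  have "(\<Sum>n = 1..m. \<Sum>k\<in>K n. odd_quotient_fps n * geometric_fps k) $ m =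
      (\<Sum>n = 1..m. \<Sum>k\<in>K n. \<Sum>i = 0..m. if ?P (n, k, i) then 1 else 0)"
    by (auto simp: fps_sum_nth fps_mult_nth odd_quotient_fps_def geometric_fps_def intro!: sum.cong)
  also have "\<dots> = (\<Sum>p\<in>?B. if ?P p then 1 else 0)"
    by (simp add: sum.Sigma sum.cartesian_product K case_prod_beta)
  also have "\<dots> = of_nat (card {p \<in> ?B. ?P p})"
    using K(1) by (subst sum.inter_filter[symmetric]) auto
  also have "card {p \<in> ?B. ?P p} = card (weighted_solutions Q m)"
  proof (rule card_eq_if_inverse[where f = "\<lambda>(n, k, i). (n, i div n, k, (m - i) div k)"
        and g = "\<lambda>(n, a, k, j). (n, k, n * a)"])
    fix p assume "p \<in> {p \<in> ?B. ?P p}"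
    moreover have "0 < k" if "k \<in> K n" for n k using less[OF K(2)[OF that]] by simp
    ultimately show "(case p of (n, k, i) \<Rightarrow> (n, i div n, k, (m - i) div k)) \<in> weighted_solutions Q m \<and>
        (case case p of (n, k, i) \<Rightarrow> (n, i div n, k, (m - i) div k) of (n, a, k, j) \<Rightarrow> (n, k, n * a)) = p"
      using K(2) by (auto simp: weighted_solutions_def dvd_imp_le div_greater_zero_iff)
  next
    fix p assume "p \<in> weighted_solutions Q m"
    moreover obtain n a k j where p: "p = (n, a, k, j)" by (cases p)
    ultimately have *: "0 < n" "odd a" "Q n k" "0 < j" "n * a + k * j = m"
      by (auto simp: weighted_solutions_def)
    have "0 < a" "n < k" using * less by (auto simp: odd_pos)
    then have "n \<le> n * a" "k \<le> k * j" "0 < k" using * by auto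
    then have "n \<le> m" "k \<le> m" "n * a < m" using * \<open>n < k\<close> by linarith+
    moreover have "m - n * a = k * j" using * by auto
    ultimately show "(case p of (n, a, k, j) \<Rightarrow> (n, k, n * a)) \<in> {p \<in> ?B. ?P p} \<and>
        (case case p of (n, a, k, j) \<Rightarrow> (n, k, n * a) of (n, k, i) \<Rightarrow> (n, i div n, k, (m - i) div k)) = p"
      using * K(3) \<open>0 < k\<close> by (auto simp: p)
  qed
  finally show ?thesis .
qed

text \<open>Modulo 4 the product is 1 plus twice a sum, and behind this factor 2
  \<open>quotient_fps n\<close> matters only modulo 2, so \<open>odd_quotient_fps n\<close> may
  replace it.\<close>

lemma sum_quotient_mult_prod_nth_mod_4:
  assumes "0 < m" and less: "\<And>n k. Q n k \<Longrightarrow> n < k"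
    and K: "\<And>n. finite (K n)" "\<And>n k. k \<in> K n \<Longrightarrow> Q n k" "\<And>n k. Q n k \<Longrightarrow> k \<le> m \<Longrightarrow> k \<in> K n"
  shows "\<exists>z. (\<Sum>n = 1..m. quotient_fps n * (\<Prod>k\<in>K n. 1 + 2 * geometric_fps k)) $ m =
    of_int (int (\<Sum>{d. d dvd m} + 2 * card (weighted_solutions Q m)) + 4 * z)"
proof -
  have "\<exists>E. integral_fps E \<and> (\<Prod>k\<in>K n. 1 + 2 * geometric_fps k) =
      1 + 2 * (\<Sum>k\<in>K n. geometric_fps k) + 4 * E" for n
    using K(1) integral_geometric_fps by (intro prod_one_plus_double)
  then obtain E where E: "\<And>n. integral_fps (E n)"
    "\<And>n. (\<Prod>k\<in>K n. 1 + 2 * geometric_fps k) = 1 + 2 * (\<Sum>k\<in>K n. geometric_fps k) + 4 * E n"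
    by metis
  obtain V where V: "\<And>n. integral_fps (V n)" "\<And>n. quotient_fps n = odd_quotient_fps n + 2 * V n"
    using quotient_fps_split by metis
  \<comment> \<open>The total cofactor of 4: one part from reducing \<open>quotient_fps n\<close>
    modulo 2, the other from expanding the product.\<close>
  define Z where "Z n = V n * (\<Sum>k\<in>K n. geometric_fps k) + quotient_fps n * E n" for n
  have "integral_fps (\<Sum>n = 1..m. Z n)"
    unfolding Z_def
    by (intro integral_fps_add integral_fps_mult integral_fps_sum V E
        integral_geometric_fps integral_quotient_fps)
  then obtain z where z: "(\<Sum>n = 1..m. Z n) $ m = of_int z"
    by (metis integral_fps_def Ints_cases)
  have "quotient_fps n * (\<Prod>k\<in>K n. 1 + 2 * geometric_fps k) =
      quotient_fps n + 2 * (\<Sum>k\<in>K n. odd_quotient_fps n * geometric_fps k) + 4 * Z n" for n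
  proof -
    have "quotient_fps n * (\<Prod>k\<in>K n. 1 + 2 * geometric_fps k) =
        quotient_fps n + 2 * (quotient_fps n * (\<Sum>k\<in>K n. geometric_fps k)) + 4 * (quotient_fps n * E n)"
      by (simp only: E(2)) (simp add: algebra_simps)
    also have "quotient_fps n * (\<Sum>k\<in>K n. geometric_fps k) =
        (\<Sum>k\<in>K n. odd_quotient_fps n * geometric_fps k) + 2 * (V n * (\<Sum>k\<in>K n. geometric_fps k))"
      by (simp add: V(2) sum_distrib_left algebra_simps)
    finally show ?thesis by (simp add: Z_def algebra_simps)
  qed
  then have "(\<Sum>n = 1..m. quotient_fps n * (\<Prod>k\<in>K n. 1 + 2 * geometric_fps k)) =
      (\<Sum>n = 1..m. quotient_fps n) +
      2 * (\<Sum>n = 1..m. \<Sum>k\<in>K n. odd_quotient_fps n * geometric_fps k) + 4 * (\<Sum>n = 1..m. Z n)"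
    by (simp add: sum.distrib sum_distrib_left)
  then have "(\<Sum>n = 1..m. quotient_fps n * (\<Prod>k\<in>K n. 1 + 2 * geometric_fps k)) $ m =
      of_nat (\<Sum>{d. d dvd m}) + 2 * of_nat (card (weighted_solutions Q m)) + 4 * of_int z"
    by (simp only: fps_add_nth numeral_fps_const fps_mult_left_const_nth sum_quotient_fps_nth[OF assms(1)]
        sum_odd_quotient_mult_geometric_nth[of Q K m, OF less K] z)
  then show ?thesis by (intro exI[of _ z]) simp
qed

section \<open>The two spt functions modulo 4\<close>

text \<open>Divisibility of \<open>T n\<close> by q^n makes the terms beyond \<open>m\<close>
  invisible at coefficient \<open>m\<close>; \<open>T'\<close> will be the terms with truncated
  products.\<close>

lemma sum_lim_nth:
  assumes "\<And>n. 0 < n \<Longrightarrow> agree_upto m (T n) (T' n)" and "\<And>n. 0 < n \<Longrightarrow> \<exists>S. T n = fps_X ^ n * S"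
  shows "lim (\<lambda>N. \<Sum>n\<in>{1..N}. T n) $ m = (\<Sum>n = 1..m. T' n) $ m"
proof -
  have "agree_upto m (lim (\<lambda>N. \<Sum>n\<in>{1..N}. T n)) (\<Sum>n\<in>{1..m}. T n)"
  proof (rule agree_upto_lim)
    fix N
    obtain S where "T (Suc N) = fps_X ^ Suc N * S" using assms(2) by blast
    then show "agree_upto N (\<Sum>n\<in>{1..Suc N}. T n) (\<Sum>n\<in>{1..N}. T n)"
      by (simp add: agree_upto_def fps_X_power_mult_nth del: power_Suc)
  qed
  moreover have "agree_upto m (\<Sum>n\<in>{1..m}. T n) (\<Sum>n\<in>{1..m}. T' n)"
    using assms(1) by (intro agree_upto_sum) auto
  ultimately show ?thesis by (simp add: agree_upto_def)
qed

lemma sptbar_mod_4: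
  assumes "0 < m"
  shows "\<exists>z. sptbar m = of_int (int (\<Sum>{d. d dvd m} + 2 * card (weighted_solutions (<) m)) + 4 * z)"
proof -
  \<comment> \<open>The exponents \<open>n + 1\<close> to \<open>n + m\<close> of the
    \<open>m\<close> factors that are kept; they include every \<open>k\<close> with
    \<open>n < k\<close> and \<open>k \<le> m\<close>.\<close>
  let ?K = "\<lambda>n. (\<lambda>j. n + 1 + j) ` {..<m}"
  let ?P = "\<lambda>n. qpoch (- (fps_X ^ (n + 1))) fps_X m" and ?Q = "\<lambda>n. qpoch (fps_X ^ (n + 1)) fps_X m"
  have term_eq: "fps_X ^ n * ?P n * inverse ((1 - fps_X ^ n)\<^sup>2 * ?Q n) =
      quotient_fps n * (\<Prod>k\<in>?K n. 1 + 2 * geometric_fps k)" if "0 < n" for n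
  proof -
    have "?P n = ?Q n * (\<Prod>k\<in>?K n. 1 + 2 * geometric_fps k)"
      using qpoch_uminus_eq[of "n + 1" 1 m] by (simp add: prod.reindex inj_on_def)
    moreover have "?Q n $ 0 = 1" by (rule qpoch_nth_0) simp
    ultimately show ?thesis by (simp only: quotient_term_eq[OF that])
  qed
  have "sptbar m = (\<Sum>n = 1..m. fps_X ^ n * ?P n * inverse ((1 - fps_X ^ n)\<^sup>2 * ?Q n)) $ m"
    unfolding sptbar_def sptbar_gf_def
  proof (rule sum_lim_nth)
    fix n :: nat assume "0 < n"
    have "agree_upto m (qpoch_inf (fps_X ^ (n + 1)) fps_X) (?Q n)"
      using agree_upto_qpoch_inf[of "fps_X ^ (n + 1)" 1 m] by simp
    moreover have "agree_upto m (qpoch_inf (- (fps_X ^ (n + 1))) fps_X) (?P n)"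
      using agree_upto_qpoch_inf[of "- (fps_X ^ (n + 1))" 1 m] by simp
    moreover from calculation(1) have "qpoch_inf (fps_X ^ (n + 1)) fps_X $ 0 = 1"
      by (simp add: agree_upto_def qpoch_nth_0)
    ultimately show "agree_upto m
        (fps_X ^ n * qpoch_inf (- (fps_X ^ (n + 1))) fps_X *
          inverse ((1 - fps_X ^ n)\<^sup>2 * qpoch_inf (fps_X ^ (n + 1)) fps_X))
        (fps_X ^ n * ?P n * inverse ((1 - fps_X ^ n)\<^sup>2 * ?Q n))"
      using \<open>0 < n\<close>
      by (intro agree_upto_mult agree_upto_inverse agree_upto_refl) (simp_all add: power2_eq_square)
  qed (metis mult.assoc)
  also have "\<dots> = (\<Sum>n = 1..m. quotient_fps n * (\<Prod>k\<in>?K n. 1 + 2 * geometric_fps k)) $ m"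
    using term_eq by (intro arg_cong[of _ _ "\<lambda>F. F $ m"] sum.cong) auto
  finally show ?thesis
  proof (simp only:, intro sum_quotient_mult_prod_nth_mod_4[OF assms])
    fix n k :: nat assume "n < k" "k \<le> m"
    then show "k \<in> ?K n" by (intro image_eqI[of _ _ "k - (n + 1)"]) auto
  qed auto
qed

lemma sptbar_omega_mod_4:
  assumes "0 < m"
  shows "\<exists>z. sptbar_omega m = of_int (int (\<Sum>{d. d dvd m} +
    2 * card (weighted_solutions (\<lambda>n k. n < k \<and> (k \<le> 2 * n \<or> even k)) m)) + 4 * z)"
proof -
  \<comment> \<open>The finite product has the exponents \<open>n + 1\<close> to
    \<open>2 * n\<close>, the infinite one the even exponents from \<open>2 * n + 2\<close> on,
    truncated after \<open>m\<close> factors.\<close>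
  let ?K1 = "\<lambda>n. (\<lambda>j. n + 1 + j) ` {..<n}" and ?K2 = "\<lambda>n. (\<lambda>j. 2 * n + 2 + 2 * j) ` {..<m}"
  let ?K = "\<lambda>n. ?K1 n \<union> ?K2 n"
  let ?P1 = "\<lambda>n. qpoch (- (fps_X ^ (n + 1))) fps_X n" and ?Q1 = "\<lambda>n. qpoch (fps_X ^ (n + 1)) fps_X n"
  let ?P2 = "\<lambda>n. qpoch (- (fps_X ^ (2 * n + 2))) (fps_X ^ 2) m"
  let ?Q2 = "\<lambda>n. qpoch (fps_X ^ (2 * n + 2)) (fps_X ^ 2) m"
  have term_eq: "fps_X ^ n * ?P1 n * ?P2 n * inverse ((1 - fps_X ^ n)\<^sup>2 * ?Q1 n * ?Q2 n) =
      quotient_fps n * (\<Prod>k\<in>?K n. 1 + 2 * geometric_fps k)" if "0 < n" for n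
  proof -
    have "?P1 n = ?Q1 n * (\<Prod>k\<in>?K1 n. 1 + 2 * geometric_fps k)"
      using qpoch_uminus_eq[of "n + 1" 1 n] by (simp add: prod.reindex inj_on_def)
    moreover have "?P2 n = ?Q2 n * (\<Prod>k\<in>?K2 n. 1 + 2 * geometric_fps k)"
      using qpoch_uminus_eq[of "2 * n + 2" 2 m] by (simp add: prod.reindex inj_on_def)
    moreover have "(\<Prod>k\<in>?K n. 1 + 2 * geometric_fps k) =
        (\<Prod>k\<in>?K1 n. 1 + 2 * geometric_fps k) * (\<Prod>k\<in>?K2 n. 1 + 2 * geometric_fps k)"
      by (rule prod.union_disjoint) auto
    ultimately have "?P1 n * ?P2 n = ?Q1 n * ?Q2 n * (\<Prod>k\<in>?K n. 1 + 2 * geometric_fps k)"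
      by (simp only: mult_ac)
    moreover have "(?Q1 n * ?Q2 n) $ 0 = 1" by (simp add: qpoch_nth_0)
    moreover have "fps_X ^ n * ?P1 n * ?P2 n * inverse ((1 - fps_X ^ n)\<^sup>2 * ?Q1 n * ?Q2 n) =
        fps_X ^ n * (?P1 n * ?P2 n) * inverse ((1 - fps_X ^ n)\<^sup>2 * (?Q1 n * ?Q2 n))"
      by (simp only: mult.assoc)
    ultimately show ?thesis by (simp only: quotient_term_eq[OF that])
  qed
  have "sptbar_omega m =
      (\<Sum>n = 1..m. fps_X ^ n * ?P1 n * ?P2 n * inverse ((1 - fps_X ^ n)\<^sup>2 * ?Q1 n * ?Q2 n)) $ m"
    unfolding sptbar_omega_def sptbar_omega_gf_def
  proof (rule sum_lim_nth)
    fix n :: nat assume "0 < n"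
    have "agree_upto m (qpoch_inf (fps_X ^ (2 * n + 2)) (fps_X ^ 2)) (?Q2 n)"
      "agree_upto m (qpoch_inf (- (fps_X ^ (2 * n + 2))) (fps_X ^ 2)) (?P2 n)"
      by (intro agree_upto_qpoch_inf; simp)+
    moreover from this(1) have "qpoch_inf (fps_X ^ (2 * n + 2)) (fps_X ^ 2) $ 0 = 1"
      by (simp add: agree_upto_def qpoch_nth_0)
    ultimately show "agree_upto m
        (fps_X ^ n * ?P1 n * qpoch_inf (- (fps_X ^ (2 * n + 2))) (fps_X ^ 2) *
          inverse ((1 - fps_X ^ n)\<^sup>2 * ?Q1 n * qpoch_inf (fps_X ^ (2 * n + 2)) (fps_X ^ 2)))
        (fps_X ^ n * ?P1 n * ?P2 n * inverse ((1 - fps_X ^ n)\<^sup>2 * ?Q1 n * ?Q2 n))"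
      using \<open>0 < n\<close>
      by (intro agree_upto_mult agree_upto_inverse agree_upto_refl)
        (simp_all add: power2_eq_square qpoch_nth_0)
  qed (metis mult.assoc)
  also have "\<dots> = (\<Sum>n = 1..m. quotient_fps n * (\<Prod>k\<in>?K n. 1 + 2 * geometric_fps k)) $ m"
    using term_eq by (intro arg_cong[of _ _ "\<lambda>F. F $ m"] sum.cong) auto
  finally show ?thesis
  proof (simp only:, intro sum_quotient_mult_prod_nth_mod_4[OF assms])
    fix n k :: nat assume k: "n < k \<and> (k \<le> 2 * n \<or> even k)" "k \<le> m"
    show "k \<in> ?K n"
    proof (cases "k \<le> 2 * n")
      case True
      then show ?thesis using k by (intro UnI1 image_eqI[of _ _ "k - (n + 1)"]) auto
    next
      case False
      then obtain l where "k = 2 * l" using k by auto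
      then show ?thesis using k False by (intro UnI2 image_eqI[of _ _ "l - (n + 1)"]) auto
    qed
  qed auto
qed

section \<open>Passing from \<open>7 n\<close> to \<open>n / 7\<close>\<close>

text \<open>Since 7 is -1 and 8 is 0 modulo 4, \<open>sum_divisors_mult_7\<close> makes the divisor
  sums at \<open>7 * n\<close> and \<open>n / 7\<close> congruent; the solution counts carry a
  factor 2, so equal parity suffices for them.\<close>

lemma congruence_mod_4:
  assumes "0 < n"
    and f: "\<And>m. 0 < m \<Longrightarrow> \<exists>z. f m = of_int (int (\<Sum>{d. d dvd m} + 2 * c m) + 4 * z)"
    and c: "even (c (7 * n)) \<longleftrightarrow> even (at_quotient_7 c n)"
  shows "\<exists>k::int. f (7 * n) - at_div7 f n = of_int (4 * k)"
proof -
  let ?s = "\<lambda>m. \<Sum>{d. d dvd m}"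
  obtain z where z: "f (7 * n) = of_int (int (?s (7 * n) + 2 * c (7 * n)) + 4 * z)"
    using f[of "7 * n"] assms(1) by auto
  have "\<exists>z. at_div7 f n = of_int (int (at_quotient_7 ?s n + 2 * at_quotient_7 c n) + 4 * z)"
  proof (cases "7 dvd n")
    case True
    then show ?thesis using f[of "n div 7"] assms(1)
      by (auto simp: at_div7_def at_quotient_7_def dvd_imp_le)
  next
    case False
    then show ?thesis by (intro exI[of _ 0]) (simp add: at_div7_def at_quotient_7_def)
  qed
  then obtain z' where z': "at_div7 f n = of_int (int (at_quotient_7 ?s n + 2 * at_quotient_7 c n) + 4 * z')"
    by blast
  let ?d = "int (?s (7 * n) + 2 * c (7 * n)) + 4 * z -
    (int (at_quotient_7 ?s n + 2 * at_quotient_7 c n) + 4 * z')"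
  have "int (?s (7 * n)) + 7 * int (at_quotient_7 ?s n) = 8 * int (?s n)"
    using sum_divisors_mult_7[OF assms(1)] by linarith
  moreover have "even (int (c (7 * n)) - int (at_quotient_7 c n))" using c by simp
  then obtain l where "int (c (7 * n)) - int (at_quotient_7 c n) = 2 * l" by (rule evenE)
  \<comment> \<open>The relations give \<open>a - a' = 8 * s - 8 * a'\<close> and
    \<open>2 * b - 2 * b' = 4 * l\<close>, which yields the explicit quotient by 4.\<close>
  moreover have "a + 2 * b + 4 * z - (a' + 2 * b' + 4 * z') = 4 * (2 * s - 2 * a' + l + z - z')"
    if "a + 7 * a' = 8 * s" "b - b' = 2 * l" for a a' b b' s l :: int
  proof -
    have "a = 8 * s - 7 * a'" "b = 2 * l + b'" using that by simp_all
    then show ?thesis by simp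
  qed
  ultimately have "?d = 4 * (2 * int (?s n) - 2 * int (at_quotient_7 ?s n) + l + z - z')"
    by (simp only: of_nat_add of_nat_mult of_nat_numeral)
  moreover have "f (7 * n) - at_div7 f n = of_int ?d"
    by (simp only: z z' of_int_diff)
  ultimately show ?thesis by metis
qed

theorem theorem1p7:
  fixes n :: nat
  assumes "n > 0"
  shows "(\<exists>k::int. sptbar (7*n) - at_div7 sptbar n = of_int (4*k))
       \<and> (\<exists>k::int. sptbar_omega (7*n) - at_div7 sptbar_omega n = of_int (4*k))"
proof
  show "\<exists>k::int. sptbar (7*n) - at_div7 sptbar n = of_int (4*k)"
    by (rule congruence_mod_4[OF assms sptbar_mod_4 even_card_weighted_solutions_less_mult_7])
  show "\<exists>k::int. sptbar_omega (7*n) - at_div7 sptbar_omega n = of_int (4*k)"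
    by (rule congruence_mod_4[OF assms sptbar_omega_mod_4 even_card_weighted_solutions_omega_mult_7])
qed

end
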